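(* Let $0<\delta<2$ and $0\le\gamma<1$ be such that $0<\delta<2(1-\gamma)$. Let $\{x_k\}$ be the random sequence generated, from $x_0=x_1\in\mathbb{R}^n$, by the momentum method $x_{k+1}=x_k-\delta\,\nabla^Bf_i(x_k)+\gamma(x_k-x_{k-1})$, where at iteration $k$ the index $i=i_k$ is drawn according to $\mathcal{R}$ at $x_k$. Define $\tilde{x}_k=\frac1k\sum_{l=1}^{k}x_l$ for $k\ge1$. Then $$\mathbb{E}[f(\tilde{x}_k)]\le\frac{(1-\gamma)^2\,d_B(x_0,\mathcal{X})^2+2\delta\gamma f(x_0)}{2\delta k(2-2\gamma-\delta)} .$$
   Context: $A\in\mathbb{R}^{m\times n}$ has no zero rows, $b\in\mathbb{R}^m$, the system $Ax\le b$ is consistent, and $\mathcal{X}=\{x\in\mathbb{R}^n: Ax\le b\}$. $B\in\mathbb{R}^{n\times n}$ is symmetric positive definite, $\|x\|_B^2=x^TBx$, $\|v\|_{B^{-1}}^2=v^TB^{-1}v$, and $d_B(x,\mathcal{X})=\inf_{y\in\mathcal{X}}\|x-y\|_B$. For a real $t$, $t^+=\max\{t,0\}$. $S_1,\dots,S_q\in\mathbb{R}^m_+$ are fixed sketching vectors (with $A^TS_i\ne 0$), and $$f_i(x)=\frac{|[S_i^T(Ax-b)]^+|^2}{2\|A^TS_i\|_{B^{-1}}^2},\qquad \nabla^B f_i(x)=\frac{[S_i^T(Ax-b)]^+}{\|A^TS_i\|_{B^{-1}}^2}B^{-1}A^TS_i .$$ A sampling rule $\mathcal{R}$ prescribes,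 given a current point $x$, how a random index $i\in\{1,\dots,q\}$ is chosen; $\mathbb{E}[\,\cdot\mid i\sim\mathcal{R}]$ is the resulting expectation, and $f(x)=\mathbb{E}[f_i(x)\mid i\sim\mathcal{R}]$.
   Formalization: The sampling rule is additionally assumed to satisfy f(y) ≥ f(x) + ⟨E[∇^B f_i(x) | i∼R], y−x⟩_B for all x, y (so f is convex with subgradient E[∇^B f_i]); for arbitrary point-dependent rules the bound is false. *)

theory Defs
  imports "HOL-Probability.Probability"
begin

definition posdef_sym :: "real^'n^'n \<Rightarrow> bool" where
  "posdef_sym B \<longleftrightarrow> transpose B = B \<and> (\<forall>x. x \<noteq> 0 \<longrightarrow> 0 < x \<bullet> (B *v x))"

definition wnorm :: "real^'n^'n \<Rightarrow> real^'n \<Rightarrow> real" where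
  "wnorm B x = sqrt (x \<bullet> (B *v x))"

definition feasible :: "real^'n^'m \<Rightarrow> real^'m \<Rightarrow> (real^'n) set" where
  "feasible A b = {x. A *v x \<le> b}"

definition wdist :: "real^'n^'n \<Rightarrow> real^'n \<Rightarrow> (real^'n) set \<Rightarrow> real" where
  "wdist B x K = (INF y\<in>K. wnorm B (x - y))"

definition pos_part :: "real \<Rightarrow> real" where
  "pos_part t = max t 0"

text \<open>The loss of a single sketching vector \<open>s\<close> and its gradient for the
  inner product \<open>\<langle>u, v\<rangle> = u \<bullet> (B *v v)\<close>.\<close>

definition sketch_loss ::
    "real^'n^'n \<Rightarrow> real^'n^'m \<Rightarrow> real^'m \<Rightarrow> real^'m \<Rightarrow> real^'n \<Rightarrow> real" where
  "sketch_loss B A b s x =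
     \<bar>pos_part (s \<bullet> (A *v x - b))\<bar>\<^sup>2 / (2 * (wnorm (matrix_inv B) (transpose A *v s))\<^sup>2)"

definition sketch_grad ::
    "real^'n^'n \<Rightarrow> real^'n^'m \<Rightarrow> real^'m \<Rightarrow> real^'m \<Rightarrow> real^'n \<Rightarrow> real^'n" where
  "sketch_grad B A b s x =
     (pos_part (s \<bullet> (A *v x - b)) / (wnorm (matrix_inv B) (transpose A *v s))\<^sup>2)
       *\<^sub>R (matrix_inv B *v (transpose A *v s))"

text \<open>A sampling rule assigns to every point \<open>x\<close> a distribution \<open>R x\<close> on the index
  type \<open>'q\<close> of the sketching vectors.\<close>

definition mean_loss ::
    "real^'n^'n \<Rightarrow> real^'n^'m \<Rightarrow> real^'m \<Rightarrow> ('q \<Rightarrow> real^'m) \<Rightarrow> (real^'n \<Rightarrow> 'q pmf)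
      \<Rightarrow> real^'n \<Rightarrow> real" where
  "mean_loss B A b S R x = measure_pmf.expectation (R x) (\<lambda>i. sketch_loss B A b (S i) x)"

definition mean_grad ::
    "real^'n^'n \<Rightarrow> real^'n^'m \<Rightarrow> real^'m \<Rightarrow> ('q \<Rightarrow> real^'m) \<Rightarrow> (real^'n \<Rightarrow> 'q pmf)
      \<Rightarrow> real^'n \<Rightarrow> real^'n" where
  "mean_grad B A b S R x = measure_pmf.expectation (R x) (\<lambda>i. sketch_grad B A b (S i) x)"

text \<open>\<open>g\<close> is a subgradient field of \<open>F\<close> for the \<open>B\<close>-inner product; in particular \<open>F\<close>
  is then convex.  For \<open>F = mean_loss B A b S R\<close> and \<open>g = mean_grad B A b S R\<close> this holds
  when \<open>R\<close> does not depend on the point, when \<open>R x\<close> picks an index of maximal loss at \<open>x\<close>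
  (from all indices, or from a random subset whose law does not depend on \<open>x\<close>), and when
  \<open>R x\<close> is uniform on \<open>t\<close> indices of largest loss at \<open>x\<close> for a fixed \<open>t\<close>.
  It fails for some point-dependent rules.\<close>

definition subgradient_field ::
    "real^'n^'n \<Rightarrow> (real^'n \<Rightarrow> real) \<Rightarrow> (real^'n \<Rightarrow> real^'n) \<Rightarrow> bool" where
  "subgradient_field B F g \<longleftrightarrow> (\<forall>x y. F x + g x \<bullet> (B *v (y - x)) \<le> F y)"

text \<open>The sigma-algebra generated by \<open>X 0, \<dots>, X k\<close>.\<close>

definition history :: "'w measure \<Rightarrow> (nat \<Rightarrow> 'w \<Rightarrow> real^'n) \<Rightarrow> nat \<Rightarrow> 'w measure" where
  "history M X k = sigma (space M) {X j -` U \<inter> space M | j U. j \<le> k \<and> U \<in> sets borel}"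

text \<open>The random index \<open>I k\<close> used in iteration \<open>k\<close> has, conditionally on the iterates up to
  \<open>X k\<close>, the distribution \<open>R (X k)\<close>.  The two starting points coincide, and the index
  \<open>I 0\<close> plays no role.\<close>

definition momentum_process ::
    "'w measure \<Rightarrow> real^'n^'n \<Rightarrow> real^'n^'m \<Rightarrow> real^'m \<Rightarrow> ('q \<Rightarrow> real^'m)
      \<Rightarrow> (real^'n \<Rightarrow> 'q pmf) \<Rightarrow> real \<Rightarrow> real \<Rightarrow> real^'n
      \<Rightarrow> (nat \<Rightarrow> 'w \<Rightarrow> 'q) \<Rightarrow> (nat \<Rightarrow> 'w \<Rightarrow> real^'n) \<Rightarrow> bool" where
  "momentum_process M B A b S R \<delta> \<gamma> x0 I X \<longleftrightarrow>
     prob_space M \<and>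
     (\<forall>k\<ge>1. I k \<in> measurable M (count_space UNIV)) \<and>
     (\<forall>\<omega>\<in>space M. X 0 \<omega> = x0 \<and> X 1 \<omega> = x0) \<and>
     (\<forall>k\<ge>1. \<forall>\<omega>\<in>space M.
        X (k + 1) \<omega> = X k \<omega> - \<delta> *\<^sub>R sketch_grad B A b (S (I k \<omega>)) (X k \<omega>)
                        + \<gamma> *\<^sub>R (X k \<omega> - X (k - 1) \<omega>)) \<and>
     (\<forall>k\<ge>1. \<forall>i. AE \<omega> in M.
        real_cond_exp M (history M X k) (indicator {\<omega>' \<in> space M. I k \<omega>' = i}) \<omega>
          = pmf (R (X k \<omega>)) i)"

definition cesaro :: "(nat \<Rightarrow> 'w \<Rightarrow> real^'n) \<Rightarrow> nat \<Rightarrow> 'w \<Rightarrow> real^'n" where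
  "cesaro X k \<omega> = (1 / real k) *\<^sub>R (\<Sum>l=1..k. X l \<omega>)"

end

theory Submission
  imports Defs
begin

text \<open>
  For a feasible \<open>y\<close> put \<open>w\<^sub>k = x\<^sub>k - \<gamma> x\<^sub>k\<^sub>-\<^sub>1 - (1 - \<gamma>) y\<close>; in this variable the momentum
  method is a plain gradient step, \<open>w\<^sub>k\<^sub>+\<^sub>1 = w\<^sub>k - \<delta> \<nabla>f\<^sub>i(x\<^sub>k)\<close>.  Expanding the square,
  with \<open>\<parallel>\<nabla>f\<^sub>i\<parallel>\<^sup>2 = 2 f\<^sub>i\<close>, \<open>\<langle>\<nabla>f\<^sub>i(x), x - y\<rangle> \<ge> 2 f\<^sub>i(x)\<close> and the subgradient inequality for
  \<open>f\<close> at \<open>x\<^sub>k\<close>, shows that the energy \<open>E[\<parallel>w\<^sub>k\<parallel>\<^sup>2 + 2\<delta>\<gamma> f(x\<^sub>k\<^sub>-\<^sub>1)]\<close> drops by at least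
  \<open>2\<delta>(2 - 2\<gamma> - \<delta>) E[f(x\<^sub>k)]\<close> per step.  Telescoping, convexity of \<open>f\<close> and the infimum over
  \<open>y\<close> give the bound.  There are finitely many indices and the start is deterministic, so every
  \<open>x\<^sub>k\<close> takes finitely many values and no integrability question arises, although \<open>R\<close> need
  not be measurable.
\<close>

section \<open>Linear algebra of the \<open>B\<close>-inner product\<close>

lemma posdef_sym_inner_commute:
  assumes "posdef_sym B"
  shows "u \<bullet> (B *v v) = v \<bullet> (B *v u)"
  by (metis assms dot_lmul_matrix inner_commute posdef_sym_def transpose_matrix_vector)

lemma posdef_sym_inner_nonneg:
  assumes "posdef_sym B"
  shows "0 \<le> u \<bullet> (B *v u)"
  using assms by (cases "u = 0") (auto simp: posdef_sym_def intro: less_imp_le)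

lemma posdef_sym_matrix_inv_vector:
  assumes "posdef_sym B"
  shows "B *v (matrix_inv B *v v) = v"
proof -
  have "x = 0" if "B *v x = 0" for x
    using assms that unfolding posdef_sym_def by (metis inner_zero_right less_irrefl)
  then have "invertible B"
    by (simp add: invertible_left_inverse matrix_left_invertible_ker)
  then have "B ** matrix_inv B = mat 1"
    unfolding matrix_inv_def invertible_def by (rule someI2_ex) simp
  then show ?thesis
    by (simp add: matrix_vector_mul_assoc)
qed

lemma wnorm_sq:
  assumes "posdef_sym B"
  shows "(wnorm B u)\<^sup>2 = u \<bullet> (B *v u)"
  by (simp add: wnorm_def posdef_sym_inner_nonneg[OF assms])

text \<open>With u = \<open>matrix_inv B *v v\<close>, the quantity under the root is u \<bullet>
  (\<open>B *v u\<close>), so its nonnegativity comes from \<open>B\<close> itself.\<close>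

lemma wnorm_matrix_inv_sq:
  assumes "posdef_sym B"
  shows "(wnorm (matrix_inv B) v)\<^sup>2 = (matrix_inv B *v v) \<bullet> v"
  using posdef_sym_inner_nonneg[OF assms, of "matrix_inv B *v v"]
  by (simp add: wnorm_def posdef_sym_matrix_inv_vector[OF assms] inner_commute)

section \<open>Sketched losses and their gradients\<close>

lemma sketch_grad_inner:
  assumes "posdef_sym B"
  shows "sketch_grad B A b s x \<bullet> (B *v d)
    = pos_part (s \<bullet> (A *v x - b)) / (wnorm (matrix_inv B) (transpose A *v s))\<^sup>2 * (s \<bullet> (A *v d))"
  unfolding posdef_sym_inner_commute[OF assms, of _ d]
  by (simp add: sketch_grad_def matrix_vector_mult_scaleR posdef_sym_matrix_inv_vector[OF assms])
     (metis dot_lmul_matrix inner_commute transpose_matrix_vector)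

text \<open>The squared \<open>B\<close>-norm of the direction
  \<open>matrix_inv B *v (transpose A *v s)\<close> is the normalising weight w, so with p the
  positive part of the residual the left side is (p/w)^2 w = p^2/w. For w = 0 both sides are 0, as
  division by zero gives 0.\<close>

lemma sketch_grad_norm_sq:
  assumes "posdef_sym B"
  shows "sketch_grad B A b s x \<bullet> (B *v sketch_grad B A b s x) = 2 * sketch_loss B A b s x"
  unfolding sketch_grad_def sketch_loss_def wnorm_matrix_inv_sq[OF assms]
  by (simp add: matrix_vector_mult_scaleR posdef_sym_matrix_inv_vector[OF assms] power2_eq_square)

text \<open>Nonnegativity of \<open>s\<close> preserves the system under sketching, so the residual
  at \<open>x\<close> is at most \<open>s \<bullet> (A *v (x - y))\<close>. Multiplying by its
  positive part turns the left side into the squared positive part.\<close>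

lemma sketch_loss_le_grad_inner:
  assumes "posdef_sym B" and "0 \<le> s" and "y \<in> feasible A b"
  shows "2 * sketch_loss B A b s x \<le> sketch_grad B A b s x \<bullet> (B *v (x - y))"
proof -
  let ?t = "s \<bullet> (A *v x - b)" and ?w = "(wnorm (matrix_inv B) (transpose A *v s))\<^sup>2"
  have "s \<bullet> (A *v y) \<le> s \<bullet> b"
    using assms(2,3) unfolding inner_vec_def feasible_def
    by (auto simp: less_eq_vec_def intro!: sum_mono mult_left_mono)
  then have "?t \<le> s \<bullet> (A *v (x - y))"
    by (simp add: matrix_vector_mult_diff_distrib inner_diff_right)
  moreover have "pos_part ?t * ?t = (pos_part ?t)\<^sup>2"
    by (simp add: pos_part_def max_def power2_eq_square)
  ultimately have "(pos_part ?t)\<^sup>2 \<le> pos_part ?t * (s \<bullet> (A *v (x - y)))"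
    by (metis max.cobounded2 mult_left_mono pos_part_def)
  then have "(pos_part ?t)\<^sup>2 / ?w \<le> pos_part ?t * (s \<bullet> (A *v (x - y))) / ?w"
    by (rule divide_right_mono) simp
  then show ?thesis
    by (simp add: sketch_loss_def sketch_grad_inner[OF assms(1)])
qed

section \<open>Averaging, and the descent in one step\<close>

lemma mean_grad_inner:
  fixes S :: "'q::finite \<Rightarrow> real^'m"
  shows "mean_grad B A b S R x \<bullet> v
    = measure_pmf.expectation (R x) (\<lambda>i. sketch_grad B A b (S i) x \<bullet> v)"
  by (simp add: mean_grad_def integrable_measure_pmf_finite)

lemma mean_loss_nonneg: "0 \<le> mean_loss B A b S R x"
  unfolding mean_loss_def by (intro Bochner_Integration.integral_nonneg) (simp add: sketch_loss_def)

text \<open>Jensen's inequality: subgradient inequalities based at the average are summed, and their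
  linear parts cancel.\<close>

lemma subgradient_field_average_le:
  fixes f :: "real^'n \<Rightarrow> real"
  assumes "subgradient_field B f g" and "1 \<le> k"
  shows "real k * f (cesaro X k \<omega>) \<le> (\<Sum>l=1..k. f (X l \<omega>))"
proof -
  let ?a = "cesaro X k \<omega>"
  have "(\<Sum>l=1..k. f ?a + g ?a \<bullet> (B *v (X l \<omega> - ?a))) \<le> (\<Sum>l=1..k. f (X l \<omega>))"
    using assms(1) by (intro sum_mono) (auto simp: subgradient_field_def)
  moreover have "(\<Sum>l=1..k. g ?a \<bullet> (B *v (X l \<omega> - ?a))) = g ?a \<bullet> (B *v (\<Sum>l=1..k. X l \<omega> - ?a))"
    by (simp add: inner_sum_right linear_sum[OF matrix_vector_mul_linear])
  moreover have "(\<Sum>l=1..k. X l \<omega> - ?a) = 0"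
    using assms(2) by (simp del: sum_constant add: sum_subtractf sum_constant_scaleR cesaro_def)
  ultimately show ?thesis
    by (simp add: sum.distrib)
qed

lemma mean_step_le:
  fixes S :: "'q::finite \<Rightarrow> real^'m" and x x' y :: "real^'n"
  assumes B: "posdef_sym B" and S: "\<And>i. 0 \<le> S i" and y: "y \<in> feasible A b"
    and sub: "subgradient_field B (mean_loss B A b S R) (mean_grad B A b S R)"
    and "0 < \<delta>" and "0 \<le> \<gamma>" and "\<gamma> < 1"
  defines "w \<equiv> x - \<gamma> *\<^sub>R x' - (1 - \<gamma>) *\<^sub>R y"
  shows "measure_pmf.expectation (R x) (\<lambda>i. (w - \<delta> *\<^sub>R sketch_grad B A b (S i) x) \<bullet>
        (B *v (w - \<delta> *\<^sub>R sketch_grad B A b (S i) x)))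
      + 2 * \<delta> * \<gamma> * mean_loss B A b S R x
      + 2 * \<delta> * (2 - 2 * \<gamma> - \<delta>) * mean_loss B A b S R x
    \<le> w \<bullet> (B *v w) + 2 * \<delta> * \<gamma> * mean_loss B A b S R x'"
proof -
  let ?g = "\<lambda>i. sketch_grad B A b (S i) x" and ?l = "\<lambda>i. sketch_loss B A b (S i) x"
  let ?E = "measure_pmf.expectation (R x)"
  note int = integrable_measure_pmf_finite[OF finite, of "R x"]
  \<comment> \<open>The first summand is controlled for each index separately by feasibility of
    \<open>y\<close>, the second only after averaging.\<close>
  have w: "w = (1 - \<gamma>) *\<^sub>R (x - y) + \<gamma> *\<^sub>R (x - x')"
    by (simp add: w_def algebra_simps)
  have expand: "(w - \<delta> *\<^sub>R g) \<bullet> (B *v (w - \<delta> *\<^sub>R g))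
      = w \<bullet> (B *v w) - 2 * \<delta> * (g \<bullet> (B *v w)) + \<delta>\<^sup>2 * (g \<bullet> (B *v g))" for g
    using posdef_sym_inner_commute[OF B, of w g]
    by (simp add: matrix_vector_mult_diff_distrib matrix_vector_mult_scaleR inner_diff_left
        inner_diff_right power2_eq_square algebra_simps)
  have point: "(w - \<delta> *\<^sub>R ?g i) \<bullet> (B *v (w - \<delta> *\<^sub>R ?g i))
      \<le> w \<bullet> (B *v w) - 2 * \<delta> * (2 * (1 - \<gamma>) * ?l i + \<gamma> * (?g i \<bullet> (B *v (x - x')))) + 2 * \<delta>\<^sup>2 * ?l i" for i
  proof -
    have "(1 - \<gamma>) * (2 * ?l i) \<le> (1 - \<gamma>) * (?g i \<bullet> (B *v (x - y)))"
      using \<open>\<gamma> < 1\<close> sketch_loss_le_grad_inner[OF B S y] by (intro mult_left_mono) auto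
    then have "2 * (1 - \<gamma>) * ?l i + \<gamma> * (?g i \<bullet> (B *v (x - x'))) \<le> ?g i \<bullet> (B *v w)"
      by (simp add: w matrix_vector_right_distrib matrix_vector_mult_scaleR inner_add_right algebra_simps)
    then have "2 * \<delta> * (2 * (1 - \<gamma>) * ?l i + \<gamma> * (?g i \<bullet> (B *v (x - x')))) \<le> 2 * \<delta> * (?g i \<bullet> (B *v w))"
      using \<open>0 < \<delta>\<close> by (intro mult_left_mono) auto
    then show ?thesis
      by (simp add: expand sketch_grad_norm_sq[OF B])
  qed
  have "?E (\<lambda>i. (w - \<delta> *\<^sub>R ?g i) \<bullet> (B *v (w - \<delta> *\<^sub>R ?g i)))
      \<le> ?E (\<lambda>i. w \<bullet> (B *v w) - 2 * \<delta> * (2 * (1 - \<gamma>) * ?l i + \<gamma> * (?g i \<bullet> (B *v (x - x')))) + 2 * \<delta>\<^sup>2 * ?l i)"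
    by (intro integral_mono int point)
  also have "\<dots> = w \<bullet> (B *v w) - 2 * \<delta> * (2 * (1 - \<gamma>) * mean_loss B A b S R x
      + \<gamma> * (mean_grad B A b S R x \<bullet> (B *v (x - x')))) + 2 * \<delta>\<^sup>2 * mean_loss B A b S R x"
    by (simp add: int mean_loss_def mean_grad_inner)
  finally have *: "?E (\<lambda>i. (w - \<delta> *\<^sub>R ?g i) \<bullet> (B *v (w - \<delta> *\<^sub>R ?g i))) \<le> \<dots>" .
  \<comment> \<open>Averaging the convexity of the single losses would yield their mean at
    \<open>x'\<close> under \<open>R x\<close>, whereas \<open>mean_loss\<close> at
    \<open>x'\<close> averages under \<open>R x'\<close>. The subgradient hypothesis bridges this
    gap.\<close>
  have "mean_loss B A b S R x + mean_grad B A b S R x \<bullet> (B *v (x' - x)) \<le> mean_loss B A b S R x'"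
    using sub by (auto simp: subgradient_field_def)
  moreover have "mean_grad B A b S R x \<bullet> (B *v (x' - x)) = - (mean_grad B A b S R x \<bullet> (B *v (x - x')))"
    by (simp add: matrix_vector_mult_diff_distrib inner_diff_right)
  ultimately have "2 * \<delta> * \<gamma> * (mean_loss B A b S R x - mean_loss B A b S R x')
      \<le> 2 * \<delta> * \<gamma> * (mean_grad B A b S R x \<bullet> (B *v (x - x')))"
    using \<open>0 < \<delta>\<close> \<open>0 \<le> \<gamma>\<close> by (intro mult_left_mono) auto
  \<comment> \<open>The constant arises as 4\<delta>(1 - \<gamma>) - 2\<delta>^2 = 2\<delta>(2 -
    2\<gamma> - \<delta>).\<close>
  then show ?thesis
    using * by (simp add: algebra_simps power2_eq_square)
qed

section \<open>Expectation over an index drawn conditionally on the past\<close>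

lemma (in prob_space) expectation_sampled_index:
  fixes I :: "'a \<Rightarrow> 'q::finite" and h :: "'q \<Rightarrow> 'a \<Rightarrow> real"
  assumes F: "subalgebra M F"
    and I: "I \<in> measurable M (count_space UNIV)"
    and law: "\<And>i. AE \<omega> in M. real_cond_exp M F (indicator {\<omega>' \<in> space M. I \<omega>' = i}) \<omega> = pmf (p \<omega>) i"
    and p: "\<And>i. (\<lambda>\<omega>. pmf (p \<omega>) i) \<in> borel_measurable M"
    and h: "\<And>i. h i \<in> borel_measurable F" "\<And>i. integrable M (h i)"
  shows "expectation (\<lambda>\<omega>. h (I \<omega>) \<omega>)
    = expectation (\<lambda>\<omega>. measure_pmf.expectation (p \<omega>) (\<lambda>i. h i \<omega>))"
proof -
  interpret finite_measure_subalgebra M F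
    by unfold_locales (rule F)
  let ?J = "\<lambda>i. indicator {\<omega>' \<in> space M. I \<omega>' = i} :: 'a \<Rightarrow> real"
  let ?c = "\<lambda>i. real_cond_exp M F (?J i)"
  have J: "{\<omega>' \<in> space M. I \<omega>' = i} \<in> sets M" for i
    using measurable_sets[OF I, of "{i}"] by (simp add: vimage_def Int_def conj_commute)
  have hM: "h i \<in> borel_measurable M" for i
    using h(2) by auto
  have hJ: "integrable M (\<lambda>\<omega>. h i \<omega> * ?J i \<omega>)" for i
    using integrable_real_mult_indicator[OF J h(2)] .
  note c = real_cond_exp_intg[OF hJ h(1) borel_measurable_indicator[OF J]]
  \<comment> \<open>After splitting over the finitely many indices, \<open>I\<close> enters only
    through the indicators \<open>?J i\<close>. Since \<open>h i\<close> is
    \<open>F\<close>-measurable, each may be replaced under the integral by its conditional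
    expectation.\<close>
  have "expectation (\<lambda>\<omega>. h (I \<omega>) \<omega>) = expectation (\<lambda>\<omega>. \<Sum>i\<in>UNIV. h i \<omega> * ?J i \<omega>)"
  proof (rule Bochner_Integration.integral_cong[OF refl])
    fix \<omega> assume "\<omega> \<in> space M"
    then have "(\<Sum>i\<in>UNIV. h i \<omega> * ?J i \<omega>) = (\<Sum>i\<in>UNIV. if i = I \<omega> then h i \<omega> else 0)"
      by (intro sum.cong) (auto simp: indicator_def)
    then show "h (I \<omega>) \<omega> = (\<Sum>i\<in>UNIV. h i \<omega> * ?J i \<omega>)"
      by simp
  qed
  also have "\<dots> = (\<Sum>i\<in>UNIV. expectation (\<lambda>\<omega>. h i \<omega> * ?c i \<omega>))"
    by (subst Bochner_Integration.integral_sum) (auto simp only: hJ c(2))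
  also have "\<dots> = expectation (\<lambda>\<omega>. \<Sum>i\<in>UNIV. h i \<omega> * ?c i \<omega>)"
    by (simp add: c(1))
  also have "\<dots> = expectation (\<lambda>\<omega>. \<Sum>i\<in>UNIV. h i \<omega> * pmf (p \<omega>) i)"
  proof (rule integral_cong_AE)
    \<comment> \<open>Each index has its own exceptional null set; finitely many of them have a null
      union.\<close>
    have "AE \<omega> in M. \<forall>i\<in>UNIV. ?c i \<omega> = pmf (p \<omega>) i"
      by (rule AE_finite_allI) (auto intro: law)
    then show "AE \<omega> in M. (\<Sum>i\<in>UNIV. h i \<omega> * ?c i \<omega>) = (\<Sum>i\<in>UNIV. h i \<omega> * pmf (p \<omega>) i)"
      by eventually_elim simp
  qed (use hM p in auto)
  also have "\<dots> = expectation (\<lambda>\<omega>. measure_pmf.expectation (p \<omega>) (\<lambda>i. h i \<omega>))"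
    by (simp add: integral_measure_pmf[where A=UNIV] mult.commute)
  finally show ?thesis .
qed

section \<open>Finite range of the iterates, and their history\<close>

lemma momentum_process_simple_function:
  fixes S :: "'q::finite \<Rightarrow> real^'m" and X :: "nat \<Rightarrow> 'w \<Rightarrow> real^'n"
  assumes P: "momentum_process M B A b S R \<delta> \<gamma> x0 I X"
  shows "simple_function M (X k)"
proof -
  have X0: "X 0 \<omega> = x0" "X 1 \<omega> = x0" if "\<omega> \<in> space M" for \<omega>
    using P that by (auto simp: momentum_process_def)
  have I: "simple_function M (I k)" if "1 \<le> k" for k
  proof -
    have "I k \<in> measurable M (count_space UNIV)"
      using P that by (auto simp: momentum_process_def)
    then show ?thesis
      by (auto simp: simple_function_def)
  qed
  \<comment> \<open>The recursion looks back two steps, so the induction carries two consecutive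
    iterates.\<close>
  have "simple_function M (X k) \<and> simple_function M (X (k + 1))"
  proof (induction k)
    case 0
    show ?case
      using X0 simple_function_cong[of M "X 0" "\<lambda>_. x0"] simple_function_cong[of M "X 1" "\<lambda>_. x0"]
      by simp
  next
    case (Suc k)
    let ?F = "\<lambda>(i, x, x'). x - \<delta> *\<^sub>R sketch_grad B A b (S i) x + \<gamma> *\<^sub>R (x - x')"
    have "simple_function M (?F \<circ> (\<lambda>\<omega>. (I (Suc k) \<omega>, X (Suc k) \<omega>, X k \<omega>)))"
      using Suc I[of "Suc k"] by (intro simple_function_compose simple_function_Pair) auto
    moreover have "X (Suc k + 1) \<omega> = (?F \<circ> (\<lambda>\<omega>. (I (Suc k) \<omega>, X (Suc k) \<omega>, X k \<omega>))) \<omega>"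
      if "\<omega> \<in> space M" for \<omega>
      using P that unfolding momentum_process_def by (auto dest!: spec[of _ "Suc k"])
    ultimately have "simple_function M (X (Suc k + 1))"
      using simple_function_cong by blast
    with Suc show ?case
      by simp
  qed
  then show ?thesis ..
qed

lemma sets_history:
  "sets (history M X k)
    = sigma_sets (space M) {X j -` U \<inter> space M | j U. j \<le> k \<and> U \<in> sets borel}"
  unfolding history_def by (rule sets_measure_of) auto

lemma space_history [simp]: "space (history M X k) = space M"
  unfolding history_def by (rule space_measure_of) auto

lemma subalgebra_history:
  assumes "\<And>j. X j \<in> borel_measurable M"
  shows "subalgebra M (history M X k)"
  unfolding subalgebra_def sets_history
  by (auto intro!: sets.sigma_sets_subset measurable_sets[OF assms])

text \<open>Singletons are Borel, so the level sets of \<open>X j\<close> are among the generators.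
  Arbitrary functions of past iterates, Borel or not, thereby become measurable for the
  history.\<close>

lemma simple_function_history:
  assumes "simple_function M (X j)" and "j \<le> k"
  shows "simple_function (history M X k) (X j)"
proof -
  have "X j -` {x} \<inter> space M \<in> sets (history M X k)" for x
    unfolding sets_history using assms(2) by (intro sigma_sets.Basic) (auto intro!: exI[of _ j] exI[of _ "{x}"])
  then show ?thesis
    using assms(1) by (simp add: simple_function_def)
qed

text \<open>\<open>G\<close> can be arbitrary because its arguments take finitely many values; this
  also covers expressions built from a non-measurable \<open>R\<close>.\<close>

lemma momentum_process_expectation:
  fixes S :: "'q::finite \<Rightarrow> real^'m" and X :: "nat \<Rightarrow> 'w \<Rightarrow> real^'n"
    and G :: "'q \<Rightarrow> real^'n \<Rightarrow> real^'n \<Rightarrow> real"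
  assumes P: "momentum_process M B A b S R \<delta> \<gamma> x0 I X" and "1 \<le> k"
  shows "prob_space.expectation M (\<lambda>\<omega>. G (I k \<omega>) (X k \<omega>) (X (k - 1) \<omega>))
    = prob_space.expectation M
        (\<lambda>\<omega>. measure_pmf.expectation (R (X k \<omega>)) (\<lambda>i. G i (X k \<omega>) (X (k - 1) \<omega>)))"
proof -
  interpret prob_space M
    using P by (simp add: momentum_process_def)
  note X = momentum_process_simple_function[OF P]
  have hist: "simple_function (history M X k) (\<lambda>\<omega>. G i (X k \<omega>) (X (k - 1) \<omega>))" for i
    by (intro simple_function_compose2[where h="G i"] simple_function_history X) auto
  have "simple_function M (\<lambda>\<omega>. G i (X k \<omega>) (X (k - 1) \<omega>))" for i
    by (intro simple_function_compose2[where h="G i"] X)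
  then have "integrable M (\<lambda>\<omega>. G i (X k \<omega>) (X (k - 1) \<omega>))" for i
    by (rule integrable_simple_function) simp
  moreover have "(\<lambda>\<omega>. pmf (R (X k \<omega>)) i) \<in> borel_measurable M" for i
    by (intro borel_measurable_simple_function simple_function_compose1[OF X, where g="\<lambda>x. pmf (R x) i"])
  ultimately show ?thesis
    using P \<open>1 \<le> k\<close> hist X unfolding momentum_process_def
    by (intro expectation_sampled_index[where F="history M X k"] subalgebra_history)
      (auto intro: borel_measurable_simple_function)
qed

section \<open>Telescoping the energy\<close>

lemma momentum_process_energy:
  fixes S :: "'q::finite \<Rightarrow> real^'m" and X :: "nat \<Rightarrow> 'w \<Rightarrow> real^'n"
  assumes P: "momentum_process M B A b S R \<delta> \<gamma> x0 I X"
    and B: "posdef_sym B" and S: "\<And>i. 0 \<le> S i" and y: "y \<in> feasible A b"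
    and sub: "subgradient_field B (mean_loss B A b S R) (mean_grad B A b S R)"
    and pars: "0 < \<delta>" "0 \<le> \<gamma>" "\<gamma> < 1"
  shows "2 * \<delta> * (2 - 2 * \<gamma> - \<delta>)
      * (\<Sum>l=1..k. prob_space.expectation M (\<lambda>\<omega>. mean_loss B A b S R (X l \<omega>)))
    \<le> (1 - \<gamma>)\<^sup>2 * (wnorm B (x0 - y))\<^sup>2 + 2 * \<delta> * \<gamma> * mean_loss B A b S R x0"
proof -
  interpret prob_space M
    using P by (simp add: momentum_process_def)
  let ?f = "mean_loss B A b S R"
  let ?c = "2 * \<delta> * (2 - 2 * \<gamma> - \<delta>)"
  \<comment> \<open>\<open>q\<close> is the squared \<open>B\<close>-norm of the shifted variable
    and \<open>Q\<close> the energy, indexed so that \<open>Q 0\<close> involves only the two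
    starting points. \<open>G\<close> is the value of \<open>q\<close> after a step with index
    \<open>i\<close>, written in the form that \<open>momentum_process_expectation\<close>
    accepts.\<close>
  define q where "q x x' = (x - \<gamma> *\<^sub>R x' - (1 - \<gamma>) *\<^sub>R y) \<bullet> (B *v (x - \<gamma> *\<^sub>R x' - (1 - \<gamma>) *\<^sub>R y))" for x x'
  define Q where "Q l = expectation (\<lambda>\<omega>. q (X (l + 1) \<omega>) (X l \<omega>) + 2 * \<delta> * \<gamma> * ?f (X l \<omega>))" for l
  define G where "G i x x' = q (x - \<delta> *\<^sub>R sketch_grad B A b (S i) x + \<gamma> *\<^sub>R (x - x')) x" for i x x'
  note X = momentum_process_simple_function[OF P]
  have int2: "integrable M (\<lambda>\<omega>. h (X l \<omega>) (X l' \<omega>))" for h :: "real^'n \<Rightarrow> real^'n \<Rightarrow> real" and l l'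
    by (rule integrable_simple_function) (auto intro: simple_function_compose2[where h=h] X)
  note int1 = int2[of "\<lambda>x _. h x" for h]
  have step: "Q (Suc l) + ?c * expectation (\<lambda>\<omega>. ?f (X (Suc l) \<omega>)) \<le> Q l" for l
  proof -
    have *: "measure_pmf.expectation (R x) (\<lambda>i. G i x x') + 2 * \<delta> * \<gamma> * ?f x + ?c * ?f x
        \<le> q x x' + 2 * \<delta> * \<gamma> * ?f x'" for x x'
    proof -
      have "x - \<delta> *\<^sub>R g + \<gamma> *\<^sub>R (x - x') - \<gamma> *\<^sub>R x - (1 - \<gamma>) *\<^sub>R y
          = x - \<gamma> *\<^sub>R x' - (1 - \<gamma>) *\<^sub>R y - \<delta> *\<^sub>R g" for g
        by (simp add: algebra_simps)
      then show ?thesis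
        using mean_step_le[OF B S y sub pars, of x x'] by (simp only: G_def q_def)
    qed
    have "expectation (\<lambda>\<omega>. q (X (Suc l + 1) \<omega>) (X (Suc l) \<omega>))
        = expectation (\<lambda>\<omega>. G (I (Suc l) \<omega>) (X (Suc l) \<omega>) (X l \<omega>))"
      using P unfolding momentum_process_def G_def
      by (intro Bochner_Integration.integral_cong refl) (auto dest!: spec[of _ "Suc l"])
    also have "\<dots> = expectation
        (\<lambda>\<omega>. measure_pmf.expectation (R (X (Suc l) \<omega>)) (\<lambda>i. G i (X (Suc l) \<omega>) (X l \<omega>)))"
      using momentum_process_expectation[OF P, of "Suc l" G] by simp
    finally have "Q (Suc l) + ?c * expectation (\<lambda>\<omega>. ?f (X (Suc l) \<omega>))
        = expectation (\<lambda>\<omega>. measure_pmf.expectation (R (X (Suc l) \<omega>)) (\<lambda>i. G i (X (Suc l) \<omega>) (X l \<omega>))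
            + 2 * \<delta> * \<gamma> * ?f (X (Suc l) \<omega>) + ?c * ?f (X (Suc l) \<omega>))"
      using int2[of "\<lambda>x x'. measure_pmf.expectation (R x) (\<lambda>i. G i x x')" "Suc l" l]
      by (simp add: Q_def int2 int1)
    also have "\<dots> \<le> Q l"
      unfolding Q_def
      using int2[of "\<lambda>x x'. measure_pmf.expectation (R x) (\<lambda>i. G i x x')" "Suc l" l]
      by (intro integral_mono) (auto simp: int2 int1 * simp flip: Suc_eq_plus1)
    finally show ?thesis .
  qed
  have "Q k + ?c * (\<Sum>l=1..k. expectation (\<lambda>\<omega>. ?f (X l \<omega>))) \<le> Q 0"
  proof (induction k)
    case (Suc k)
    then show ?case
      using step[of k] by (simp add: ring_distribs)
  qed simp
  moreover have "0 \<le> Q k"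
    unfolding Q_def q_def using pars posdef_sym_inner_nonneg[OF B]
    by (intro Bochner_Integration.integral_nonneg) (auto intro!: add_nonneg_nonneg simp: mean_loss_nonneg)
  \<comment> \<open>Because the starting points coincide, the shifted variable is (1 - \<gamma>)
    times \<open>x0 - y\<close>; hence the factor (1 - \<gamma>)^2.\<close>
  moreover have "Q 0 = (1 - \<gamma>)\<^sup>2 * (wnorm B (x0 - y))\<^sup>2 + 2 * \<delta> * \<gamma> * ?f x0"
  proof -
    have "Q 0 = expectation (\<lambda>\<omega>. q x0 x0 + 2 * \<delta> * \<gamma> * ?f x0)"
      unfolding Q_def using P
      by (intro Bochner_Integration.integral_cong refl) (auto simp: momentum_process_def)
    moreover have "x0 - \<gamma> *\<^sub>R x0 - (1 - \<gamma>) *\<^sub>R y = (1 - \<gamma>) *\<^sub>R (x0 - y)"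
      by (simp add: algebra_simps)
    then have "q x0 x0 = (1 - \<gamma>)\<^sup>2 * (wnorm B (x0 - y))\<^sup>2"
      unfolding q_def wnorm_sq[OF B]
      by (simp add: matrix_vector_mult_scaleR power2_eq_square)
    ultimately show ?thesis
      by (simp add: prob_space)
  qed
  ultimately show ?thesis
    by linarith
qed

section \<open>Infimum over feasible points and conclusion\<close>

lemma le_wdist_sq:
  assumes "K \<noteq> {}" and "\<And>y. y \<in> K \<Longrightarrow> C \<le> (wnorm B (x - y))\<^sup>2"
    and nonneg: "\<And>u. 0 \<le> wnorm B u"
  shows "C \<le> (wdist B x K)\<^sup>2"
\<comment> \<open>The bound is compared with the infimum after taking roots, which needs
  \<open>C\<close> nonnegative. A negative \<open>C\<close>, possible in the application since f(x0)
  is subtracted there, lies below any square.\<close>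
proof (cases "0 \<le> C")
  case True
  have "sqrt C \<le> wdist B x K"
    unfolding wdist_def using assms by (intro cINF_greatest) (auto intro: real_le_lsqrt)
  then show ?thesis
    using True by (metis power_mono real_sqrt_ge_zero real_sqrt_pow2)
qed (use zero_le_power2[of "wdist B x K"] in linarith)

theorem theorem6p9:
  fixes A :: "real^'n^'m" and b :: "real^'m" and B :: "real^'n^'n"
    and S :: "'q::finite \<Rightarrow> real^'m" and R :: "real^'n \<Rightarrow> 'q pmf"
    and \<delta> \<gamma> :: real and x0 :: "real^'n"
    and M :: "'w measure" and I :: "nat \<Rightarrow> 'w \<Rightarrow> 'q" and X :: "nat \<Rightarrow> 'w \<Rightarrow> real^'n"
    and k :: nat
  assumes "\<And>j. row j A \<noteq> 0"
    and "feasible A b \<noteq> {}"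
    and "posdef_sym B"
    and "\<And>i. 0 \<le> S i"
    and "\<And>i. transpose A *v S i \<noteq> 0"
    and "subgradient_field B (mean_loss B A b S R) (mean_grad B A b S R)"
    and "0 < \<delta>" and "\<delta> < 2"
    and "0 \<le> \<gamma>" and "\<gamma> < 1"
    and "\<delta> < 2 * (1 - \<gamma>)"
    and "momentum_process M B A b S R \<delta> \<gamma> x0 I X"
    and "1 \<le> k"
  shows "prob_space.expectation M (\<lambda>\<omega>. mean_loss B A b S R (cesaro X k \<omega>))
     \<le> ((1 - \<gamma>)\<^sup>2 * (wdist B x0 (feasible A b))\<^sup>2 + 2 * \<delta> * \<gamma> * mean_loss B A b S R x0)
        / (2 * \<delta> * real k * (2 - 2 * \<gamma> - \<delta>))"
proof -
  let ?f = "mean_loss B A b S R"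
  let ?c = "2 * \<delta> * (2 - 2 * \<gamma> - \<delta>)"
  note P = assms(12)
  interpret prob_space M
    using P by (simp add: momentum_process_def)
  let ?s = "\<Sum>l=1..k. expectation (\<lambda>\<omega>. ?f (X l \<omega>))"
  have c: "0 < ?c"
    using assms(7,11) by simp
  note X = momentum_process_simple_function[OF P]
  have int: "integrable M (\<lambda>\<omega>. ?f (Y \<omega>))" if "simple_function M Y" for Y
    by (rule integrable_simple_function) (auto intro: simple_function_compose1 that)
  have "simple_function M (cesaro X k)"
    unfolding cesaro_def
    by (intro simple_function_compose1[where g="\<lambda>x. (1 / real k) *\<^sub>R x"] simple_function_sum X)
  then have "real k * expectation (\<lambda>\<omega>. ?f (cesaro X k \<omega>)) \<le> expectation (\<lambda>\<omega>. \<Sum>l=1..k. ?f (X l \<omega>))"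
    using subgradient_field_average_le[OF assms(6,13)]
    by (subst integral_mult_right_zero[symmetric])
       (intro integral_mono, auto simp: int X)
  also have "\<dots> = ?s"
    by (simp add: int X)
  finally have jensen: "real k * expectation (\<lambda>\<omega>. ?f (cesaro X k \<omega>)) \<le> ?s" .
  \<comment> \<open>The energy bound is solved for the squared distance, leaving \<open>y\<close>
    only on the right, before the infimum is taken.\<close>
  have "(?c * ?s - 2 * \<delta> * \<gamma> * ?f x0) / (1 - \<gamma>)\<^sup>2 \<le> (wdist B x0 (feasible A b))\<^sup>2"
  proof (rule le_wdist_sq[OF assms(2)])
    fix y assume "y \<in> feasible A b"
    from momentum_process_energy[OF P assms(3,4) this assms(6,7,9,10), of k]
    show "(?c * ?s - 2 * \<delta> * \<gamma> * ?f x0) / (1 - \<gamma>)\<^sup>2 \<le> (wnorm B (x0 - y))\<^sup>2"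
      using assms(10) by (subst pos_divide_le_eq) (auto simp: mult.commute)
  qed (simp add: wnorm_def posdef_sym_inner_nonneg[OF assms(3)])
  then have "?c * ?s \<le> (1 - \<gamma>)\<^sup>2 * (wdist B x0 (feasible A b))\<^sup>2 + 2 * \<delta> * \<gamma> * ?f x0"
    using assms(10) by (subst (asm) pos_divide_le_eq) (auto simp: mult.commute)
  \<comment> \<open>Jensen's inequality is scaled by \<open>?c\<close>, which is positive exactly
    because \<delta> < 2(1 - \<gamma>), given \<delta> > 0.\<close>
  then have "?c * (real k * expectation (\<lambda>\<omega>. ?f (cesaro X k \<omega>)))
      \<le> (1 - \<gamma>)\<^sup>2 * (wdist B x0 (feasible A b))\<^sup>2 + 2 * \<delta> * \<gamma> * ?f x0"
    using mult_left_mono[OF jensen less_imp_le[OF c]] by (rule order_trans[rotated])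
  then show ?thesis
    using assms(7,11,13) by (subst pos_le_divide_eq) (auto simp: mult_ac intro!: mult_pos_pos)
qed

end
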